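(* Let $L$ be any of the fifteen logics of the modal cube and $\mathcal M_L$ its Nmatrix. Every partial level-valuation $v$ (for $L$, with domain $\Lambda$) can be extended to a level-valuation, i.e. there is $v'\in L(\mathcal M_L)$ with $v'(\beta)=v(\beta)$ for all $\beta\in\Lambda$.
   Context: Syntax and logics. Formulas: $\alpha ::= p \mid \bot \mid \alpha\to\alpha \mid \Box\alpha$; $\mathrm{For}$ is the set of formulas; $\neg\alpha:=\alpha\to\bot$, $\Diamond\alpha:=\neg\Box\neg\alpha$. $\mathbf K$: classical propositional axioms, (k) $\Box(\alpha\to\beta)\to(\Box\alpha\to\Box\beta)$, modus ponens, necessitation. Axiom schemes (D) $\Box\alpha\to\Diamond\alpha$, (T) $\Box\alpha\to\alpha$, (B) $\alpha\to\Box\Diamond\alpha$, (4) $\Box\alpha\to\Box\Box\alpha$, (5) $\Diamond\alpha\to\Box\Diamond\alpha$. The modal cube: $\mathbf K,\mathbf{KB},\mathbf{K4},\mathbf{K5},\mathbf{K45},\mathbf{KD},\mathbf{KDB},\mathbf{KD4},\mathbf{KD5},\mathbf{KD45},\mathbf{KT},\mathbf{KTB},\mathbf{S4}=\mathbf{KT4},\mathbf{S5}=\mathbf{KTB45},\mathbf{KB5}=\mathbf{KB45}$. Truth values $\mathbf{F},\mathbf{f},\mathbf{f}_2,\mathbf{f}_3,\mathbf{t}_3,\mathbf{t}_2,\mathbf{t},\mathbf{T}$. Distinguished sets: $\mathcal D=\{\mathbf T,\mathbf t,\mathbf t_2,\mathbf t_3\}$ (designated), $N=\{\mathbf T,\mathbf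 t_2,\mathbf f_3,\mathbf f_2\}$, $I=\{\mathbf F,\mathbf f_2,\mathbf t_3,\mathbf t_2\}$, $P=\{\mathbf T,\mathbf t,\mathbf f_3,\mathbf f\}$, $PN=\{\mathbf F,\mathbf f,\mathbf t_3,\mathbf t\}$. Nmatrix $\mathcal M_L$. Values $V(L)$: all eight values for $\mathbf K,\mathbf{KB},\mathbf{K4},\mathbf{K5},\mathbf{K45}$; $\{\mathbf F,\mathbf f,\mathbf f_2,\mathbf t_2,\mathbf t,\mathbf T\}$ for $\mathbf{KB5}$; $\{\mathbf F,\mathbf f,\mathbf f_3,\mathbf t_3,\mathbf t,\mathbf T\}$ for $\mathbf{KD},\mathbf{KDB},\mathbf{KD4},\mathbf{KD5},\mathbf{KD45}$; $\{\mathbf F,\mathbf f,\mathbf t,\mathbf T\}$ for $\mathbf{KT},\mathbf{KTB},\mathbf{S4},\mathbf{S5}$. $\tilde\bot=\{\mathbf F,\mathbf f_2\}$. $\tilde\to(x,y)$, restricted to arguments in $V(L)$, listed for $y=\mathbf F,\mathbf f,\mathbf f_2,\mathbf f_3,\mathbf t_3,\mathbf t_2,\mathbf t,\mathbf T$: $x=\mathbf F$: $\{\mathbf T\}$ for all $y$; $x=\mathbf f$: $\{\mathbf t\},\{\mathbf T,\mathbf t\},\{\mathbf t_2\},\{\mathbf T\},\{\mathbf t\},\{\mathbf T\},\{\mathbf T,\mathbf t\},\{\mathbf T\}$; $x=\mathbf f_2$ and $x=\mathbf f_3$: $\{\mathbf t_3\},\{\mathbf t\},\{\mathbf t_2\},\{\mathbf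 T\},\{\mathbf t_3\},\{\mathbf t_2\},\{\mathbf t\},\{\mathbf T\}$; $x=\mathbf t_3$: $\{\mathbf f_3\}$ for $y\in\{\mathbf F,\mathbf f,\mathbf f_2,\mathbf f_3\}$, $\{\mathbf T\}$ otherwise; $x=\mathbf t_2$: $\{\mathbf F\},\{\mathbf f\},\{\mathbf f_2\},\{\mathbf f_3\},\{\mathbf t_3\},\{\mathbf t_2\},\{\mathbf t_3\},\{\mathbf T\}$; $x=\mathbf t$: $\{\mathbf f\},\{\mathbf f,\mathbf f_3\},\{\mathbf f_3\},\{\mathbf f_3\},\{\mathbf t\},\{\mathbf T\},\{\mathbf T,\mathbf t\},\{\mathbf T\}$; $x=\mathbf T$: $\{\mathbf F\},\{\mathbf f\},\{\mathbf f_2\},\{\mathbf f_3\},\{\mathbf t_3\},\{\mathbf t_2\},\{\mathbf t\},\{\mathbf T\}$. $\tilde\Box$ (argument $\mapsto$ output): $\mathbf K$: $\mathbf F,\mathbf f,\mathbf t_3,\mathbf t\mapsto\{\mathbf F,\mathbf f,\mathbf f_3\}$; $\mathbf f_2,\mathbf t_2\mapsto\{\mathbf t_2\}$; $\mathbf f_3,\mathbf T\mapsto\{\mathbf T,\mathbf t,\mathbf t_3\}$. $\mathbf{KB}$: $\mathbf F,\mathbf f\mapsto\{\mathbf F\}$; $\mathbf f_2,\mathbf t_2\mapsto\{\mathbf t_2\}$; $\mathbf f_3\mapsto\{\mathbf t_3\}$; $\mathbf t_3,\mathbf t\mapsto\{\mathbf F,\mathbf f,\mathbf f_3\}$; $\mathbf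 T\mapsto\{\mathbf T,\mathbf t,\mathbf t_3\}$. $\mathbf{K4}$: $\mathbf F,\mathbf f,\mathbf t_3,\mathbf t\mapsto\{\mathbf F,\mathbf f,\mathbf f_3\}$; $\mathbf f_2,\mathbf t_2\mapsto\{\mathbf t_2\}$; $\mathbf f_3,\mathbf T\mapsto\{\mathbf T\}$. $\mathbf{K5}$: $\mathbf F,\mathbf f,\mathbf t_3,\mathbf t\mapsto\{\mathbf F\}$; $\mathbf f_2,\mathbf t_2\mapsto\{\mathbf t_2\}$; $\mathbf f_3,\mathbf T\mapsto\{\mathbf T,\mathbf t_3\}$. $\mathbf{K45}$: $\mathbf F,\mathbf f,\mathbf t_3,\mathbf t\mapsto\{\mathbf F\}$; $\mathbf f_2,\mathbf t_2\mapsto\{\mathbf t_2\}$; $\mathbf f_3,\mathbf T\mapsto\{\mathbf T\}$. $\mathbf{KB5}$: $\mathbf F,\mathbf f,\mathbf t\mapsto\{\mathbf F\}$; $\mathbf f_2,\mathbf t_2\mapsto\{\mathbf t_2\}$; $\mathbf T\mapsto\{\mathbf T\}$. $\mathbf{KD}$: $\mathbf F,\mathbf f,\mathbf t_3,\mathbf t\mapsto\{\mathbf F,\mathbf f,\mathbf f_3\}$; $\mathbf f_3,\mathbf T\mapsto\{\mathbf T,\mathbf t,\mathbf t_3\}$. $\mathbf{KDB}$: $\mathbf F,\mathbf f\mapsto\{\mathbf F\}$; $\mathbf f_3\mapsto\{\mathbf t_3\}$; $\mathbf t_3,\mathbf t\mapsto\{\mathbf F,\mathbf f,\mathbf f_3\}$;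 $\mathbf T\mapsto\{\mathbf T,\mathbf t,\mathbf t_3\}$. $\mathbf{KD4}$: $\mathbf F,\mathbf t_3\mapsto\{\mathbf F\}$; $\mathbf f,\mathbf t\mapsto\{\mathbf F,\mathbf f,\mathbf f_3\}$; $\mathbf f_3,\mathbf T\mapsto\{\mathbf T\}$. $\mathbf{KD5}$: $\mathbf F,\mathbf f,\mathbf t_3,\mathbf t\mapsto\{\mathbf F\}$; $\mathbf f_3,\mathbf T\mapsto\{\mathbf T,\mathbf t_3\}$. $\mathbf{KD45}$: $\mathbf F,\mathbf f,\mathbf t_3,\mathbf t\mapsto\{\mathbf F\}$; $\mathbf f_3,\mathbf T\mapsto\{\mathbf T\}$. $\mathbf{KT}$: $\mathbf F\mapsto\{\mathbf F\}$; $\mathbf f,\mathbf t\mapsto\{\mathbf F,\mathbf f\}$; $\mathbf T\mapsto\{\mathbf T,\mathbf t\}$. $\mathbf{KTB}$: $\mathbf F,\mathbf f\mapsto\{\mathbf F\}$; $\mathbf t\mapsto\{\mathbf F,\mathbf f\}$; $\mathbf T\mapsto\{\mathbf T,\mathbf t\}$. $\mathbf{S4}$: $\mathbf F\mapsto\{\mathbf F\}$; $\mathbf f,\mathbf t\mapsto\{\mathbf F,\mathbf f\}$; $\mathbf T\mapsto\{\mathbf T\}$. $\mathbf{S5}$: $\mathbf F,\mathbf f,\mathbf t\mapsto\{\mathbf F\}$; $\mathbf T\mapsto\{\mathbf T\}$. Partial valuations: for $\Lambda$ closed under subformulas, $[\Lambda\to V]_{\mathcal M_L}$ is the set of maps $v:\Lambda\to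 V(L)$ with $v(\bot)\in\tilde\bot$, $v(\beta\to\gamma)\in\tilde\to(v(\beta),v(\gamma))$, $v(\Box\beta)\in\tilde\Box(v(\beta))$ whenever these formulas lie in $\Lambda$. A valuation is such a map with $\Lambda=\mathrm{For}$; $\mathrm{Val}(\mathcal M_L)$ is the set of valuations. Level valuations: $L_0(\mathcal M_L)$ is the set of $v\in\mathrm{Val}(\mathcal M_L)$ such that, if $v(\beta)\in\{\mathbf f_2,\mathbf t_2\}$ for some $\beta$, then $v(\gamma)\in\{\mathbf f_2,\mathbf t_2\}$ for all $\gamma$. $L_{n+1}(\mathcal M_L)=\{v\in L_n(\mathcal M_L)\mid$ for all $\beta$, if $w(\beta)\in\mathcal D$ for every $w\in L_n(\mathcal M_L)$, then $v(\beta)\in\{\mathbf T,\mathbf t_2\}\}$. The level-valuations are $L(\mathcal M_L)=\bigcap_{n\ge0}L_n(\mathcal M_L)$. Models: a pre-model on $\Lambda$ is a pair $\langle\Pi,R\rangle$ with $\Pi\subseteq[\Lambda\to V]_{\mathcal M_L}$ and $R\subseteq\Pi\times\Pi$ such that for all $v\in\Pi$, $\beta\in\Lambda$: if $v(\beta)\in P$ there is $w\in\Pi$ with $vRw$ and $w(\beta)\in\mathcal D$; if $v(\beta)\in PN$ there is $w\in\Pi$ with $vRw$ and $w(\beta)\notin\mathcal D$. A $\mathbf K$-model is a pre-model such that whenever $vRw$: $v(\beta)\in N\Rightarrow w(\beta)\in\mathcal D$ and $v(\beta)\in I\Rightarrow w(\beta)\notin\mathcal D$. An $L$-model is a $\mathbf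 K$-model satisfying, for each axiom scheme among (T),(D),(B),(4),(5) that holds in $L$, the following conditions for all $v,w,w'\in\Pi$, $\beta\in\Lambda$: (T): $v(\beta)\in N\Rightarrow v(\beta)\in\mathcal D$, and $v(\beta)\in I\Rightarrow v(\beta)\notin\mathcal D$; (D): $v(\beta)\in N\Rightarrow v(\beta)\in P$, and $v(\beta)\in I\Rightarrow v(\beta)\in PN$; (B): if $vRw$, then $v(\beta)\in\mathcal D\Rightarrow w(\beta)\in P$ and $v(\beta)\notin\mathcal D\Rightarrow w(\beta)\in PN$; (4): if $vRw$, then $v(\beta)\in N\Rightarrow w(\beta)\in N$ and $v(\beta)\in I\Rightarrow w(\beta)\in I$; (5): if $vRw$, then $v(\beta)\in P\Rightarrow w(\beta)\in P$ and $v(\beta)\in PN\Rightarrow w(\beta)\in PN$; moreover if $v(\beta),w(\beta)\in N$, $vRw$ and ($vRw'$ or $wRw'$) then $w'(\beta)\in N$, and likewise with $I$ in place of $N$. A partial valuation $v$ is a partial level-valuation (for $L$) if $v\in\Pi$ for some $L$-model $\langle\Pi,R\rangle$. *)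

theory Defs
  imports Main "HOL-Library.FuncSet"
begin

section \<open>Syntax and the modal cube\<close>

datatype 'p fm =
    Atom 'p
  | Bot
  | Imp "'p fm" "'p fm"  (infixr "\<^bold>\<rightarrow>" 60)
  | Box "'p fm"  ("\<box>_" [70] 70)

abbreviation Neg :: "'p fm \<Rightarrow> 'p fm"  ("\<sim>_" [70] 70)
  where "\<sim>\<alpha> \<equiv> \<alpha> \<^bold>\<rightarrow> Bot"

abbreviation Dia :: "'p fm \<Rightarrow> 'p fm"  ("\<diamond>_" [70] 70)
  where "\<diamond>\<alpha> \<equiv> \<sim>\<box>\<sim>\<alpha>"

primrec subfms :: "'p fm \<Rightarrow> 'p fm set" where
  "subfms (Atom p) = {Atom p}"
| "subfms Bot = {Bot}"
| "subfms (\<alpha> \<^bold>\<rightarrow> \<beta>) = insert (\<alpha> \<^bold>\<rightarrow> \<beta>) (subfms \<alpha> \<union> subfms \<beta>)"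
| "subfms (\<box>\<alpha>) = insert (\<box>\<alpha>) (subfms \<alpha>)"

definition subfm_closed :: "'p fm set \<Rightarrow> bool" where
  "subfm_closed \<Lambda> \<longleftrightarrow> (\<forall>\<beta>\<in>\<Lambda>. subfms \<beta> \<subseteq> \<Lambda>)"

datatype scheme = AxD | AxT | AxB | Ax4 | Ax5

primrec instances :: "scheme \<Rightarrow> 'p fm set" where
  "instances AxD = {\<box>\<alpha> \<^bold>\<rightarrow> \<diamond>\<alpha> | \<alpha>. True}"
| "instances AxT = {\<box>\<alpha> \<^bold>\<rightarrow> \<alpha> | \<alpha>. True}"
| "instances AxB = {\<alpha> \<^bold>\<rightarrow> \<box>\<diamond>\<alpha> | \<alpha>. True}"
| "instances Ax4 = {\<box>\<alpha> \<^bold>\<rightarrow> \<box>\<box>\<alpha> | \<alpha>. True}"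
| "instances Ax5 = {\<diamond>\<alpha> \<^bold>\<rightarrow> \<box>\<diamond>\<alpha> | \<alpha>. True}"

datatype logic =
    K | KB | K4 | K5 | K45 | KB5 | KD | KDB | KD4 | KD5 | KD45 | KT | KTB | S4 | S5

primrec base_schemes :: "logic \<Rightarrow> scheme set" where
  "base_schemes K = {}"
| "base_schemes KB = {AxB}"
| "base_schemes K4 = {Ax4}"
| "base_schemes K5 = {Ax5}"
| "base_schemes K45 = {Ax4, Ax5}"
| "base_schemes KB5 = {AxB, Ax4, Ax5}"
| "base_schemes KD = {AxD}"
| "base_schemes KDB = {AxD, AxB}"
| "base_schemes KD4 = {AxD, Ax4}"
| "base_schemes KD5 = {AxD, Ax5}"
| "base_schemes KD45 = {AxD, Ax4, Ax5}"
| "base_schemes KT = {AxT}"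
| "base_schemes KTB = {AxT, AxB}"
| "base_schemes S4 = {AxT, Ax4}"
| "base_schemes S5 = {AxT, AxB, Ax4, Ax5}"

inductive_set theorems :: "logic \<Rightarrow> 'p fm set" for L where
  ax_weak: "\<alpha> \<^bold>\<rightarrow> \<beta> \<^bold>\<rightarrow> \<alpha> \<in> theorems L"
| ax_dist: "(\<alpha> \<^bold>\<rightarrow> \<beta> \<^bold>\<rightarrow> \<gamma>) \<^bold>\<rightarrow> (\<alpha> \<^bold>\<rightarrow> \<beta>) \<^bold>\<rightarrow> \<alpha> \<^bold>\<rightarrow> \<gamma> \<in> theorems L"
| ax_dneg: "\<sim>\<sim>\<alpha> \<^bold>\<rightarrow> \<alpha> \<in> theorems L"
| ax_k: "\<box>(\<alpha> \<^bold>\<rightarrow> \<beta>) \<^bold>\<rightarrow> \<box>\<alpha> \<^bold>\<rightarrow> \<box>\<beta> \<in> theorems L"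
| ax_scheme: "X \<in> base_schemes L \<Longrightarrow> \<alpha> \<in> instances X \<Longrightarrow> \<alpha> \<in> theorems L"
| mp: "\<alpha> \<^bold>\<rightarrow> \<beta> \<in> theorems L \<Longrightarrow> \<alpha> \<in> theorems L \<Longrightarrow> \<beta> \<in> theorems L"
| nec: "\<alpha> \<in> theorems L \<Longrightarrow> \<box>\<alpha> \<in> theorems L"


section \<open>The Nmatrices\<close>

datatype tv = vF | vf | vf2 | vf3 | vt3 | vt2 | vt | vT

text \<open>The order of the constructors is also the column order of all tables below, which are
  written with \<^const>\<open>case_tv\<close>.\<close>

definition desig :: "tv set" where "desig = {vT, vt, vt2, vt3}"
definition vals_N :: "tv set" where "vals_N = {vT, vt2, vf3, vf2}"
definition vals_I :: "tv set" where "vals_I = {vF, vf2, vt3, vt2}"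
definition vals_P :: "tv set" where "vals_P = {vT, vt, vf3, vf}"
definition vals_PN :: "tv set" where "vals_PN = {vF, vf, vt3, vt}"

definition V :: "logic \<Rightarrow> tv set" where
  "V L =
    (if L \<in> {K, KB, K4, K5, K45} then UNIV
     else if L = KB5 then {vF, vf, vf2, vt2, vt, vT}
     else if L \<in> {KD, KDB, KD4, KD5, KD45} then {vF, vf, vf3, vt3, vt, vT}
     else {vF, vf, vt, vT})"

definition nm_bot :: "tv set" where "nm_bot = {vF, vf2}"

text \<open>One table serves all logics. Some entries lie outside \<^term>\<open>V L\<close>; these are discarded
  because valuations are required to take values in \<^term>\<open>V L\<close>.\<close>

primrec nm_imp :: "tv \<Rightarrow> tv \<Rightarrow> tv set" where
  "nm_imp vF  = case_tv {vT} {vT} {vT} {vT} {vT} {vT} {vT} {vT}"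
| "nm_imp vf  = case_tv {vt} {vT, vt} {vt2} {vT} {vt} {vT} {vT, vt} {vT}"
| "nm_imp vf2 = case_tv {vt3} {vt} {vt2} {vT} {vt3} {vt2} {vt} {vT}"
| "nm_imp vf3 = case_tv {vt3} {vt} {vt2} {vT} {vt3} {vt2} {vt} {vT}"
| "nm_imp vt3 = case_tv {vf3} {vf3} {vf3} {vf3} {vT} {vT} {vT} {vT}"
| "nm_imp vt2 = case_tv {vF} {vf} {vf2} {vf3} {vt3} {vt2} {vt3} {vT}"
| "nm_imp vt  = case_tv {vf} {vf, vf3} {vf3} {vf3} {vt} {vT} {vT, vt} {vT}"
| "nm_imp vT  = case_tv {vF} {vf} {vf2} {vf3} {vt3} {vt2} {vt} {vT}"

text \<open>The entry \<open>{}\<close> marks arguments outside \<^term>\<open>V L\<close>.\<close>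

primrec nm_box :: "logic \<Rightarrow> tv \<Rightarrow> tv set" where
  "nm_box K = case_tv
     {vF, vf, vf3} {vF, vf, vf3} {vt2} {vT, vt, vt3} {vF, vf, vf3} {vt2} {vF, vf, vf3} {vT, vt, vt3}"
| "nm_box KB = case_tv
     {vF} {vF} {vt2} {vt3} {vF, vf, vf3} {vt2} {vF, vf, vf3} {vT, vt, vt3}"
| "nm_box K4 = case_tv
     {vF, vf, vf3} {vF, vf, vf3} {vt2} {vT} {vF, vf, vf3} {vt2} {vF, vf, vf3} {vT}"
| "nm_box K5 = case_tv
     {vF} {vF} {vt2} {vT, vt3} {vF} {vt2} {vF} {vT, vt3}"
| "nm_box K45 = case_tv
     {vF} {vF} {vt2} {vT} {vF} {vt2} {vF} {vT}"
| "nm_box KB5 = case_tv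
     {vF} {vF} {vt2} {} {} {vt2} {vF} {vT}"
| "nm_box KD = case_tv
     {vF, vf, vf3} {vF, vf, vf3} {} {vT, vt, vt3} {vF, vf, vf3} {} {vF, vf, vf3} {vT, vt, vt3}"
| "nm_box KDB = case_tv
     {vF} {vF} {} {vt3} {vF, vf, vf3} {} {vF, vf, vf3} {vT, vt, vt3}"
| "nm_box KD4 = case_tv
     {vF} {vF, vf, vf3} {} {vT} {vF} {} {vF, vf, vf3} {vT}"
| "nm_box KD5 = case_tv
     {vF} {vF} {} {vT, vt3} {vF} {} {vF} {vT, vt3}"
| "nm_box KD45 = case_tv
     {vF} {vF} {} {vT} {vF} {} {vF} {vT}"
| "nm_box KT = case_tv
     {vF} {vF, vf} {} {} {} {} {vF, vf} {vT, vt}"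
| "nm_box KTB = case_tv
     {vF} {vF} {} {} {} {} {vF, vf} {vT, vt}"
| "nm_box S4 = case_tv
     {vF} {vF, vf} {} {} {} {} {vF, vf} {vT}"
| "nm_box S5 = case_tv
     {vF} {vF} {} {} {} {} {vF} {vT}"


section \<open>Partial valuations and level valuations\<close>

definition pvals :: "logic \<Rightarrow> 'p fm set \<Rightarrow> ('p fm \<Rightarrow> tv) set" where
  "pvals L \<Lambda> = {v \<in> \<Lambda> \<rightarrow>\<^sub>E V L.
     (Bot \<in> \<Lambda> \<longrightarrow> v Bot \<in> nm_bot) \<and>
     (\<forall>\<beta> \<gamma>. \<beta> \<^bold>\<rightarrow> \<gamma> \<in> \<Lambda> \<longrightarrow> v (\<beta> \<^bold>\<rightarrow> \<gamma>) \<in> nm_imp (v \<beta>) (v \<gamma>)) \<and>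
     (\<forall>\<beta>. \<box>\<beta> \<in> \<Lambda> \<longrightarrow> v (\<box>\<beta>) \<in> nm_box L (v \<beta>))}"

definition Val :: "logic \<Rightarrow> ('p fm \<Rightarrow> tv) set" where
  "Val L = pvals L UNIV"

primrec level :: "logic \<Rightarrow> nat \<Rightarrow> ('p fm \<Rightarrow> tv) set" where
  "level L 0 = {v \<in> Val L. (\<exists>\<beta>. v \<beta> \<in> {vf2, vt2}) \<longrightarrow> (\<forall>\<gamma>. v \<gamma> \<in> {vf2, vt2})}"
| "level L (Suc n) =
     {v \<in> level L n. \<forall>\<beta>. (\<forall>w \<in> level L n. w \<beta> \<in> desig) \<longrightarrow> v \<beta> \<in> {vT, vt2}}"

definition level_valuations :: "logic \<Rightarrow> ('p fm \<Rightarrow> tv) set" where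
  "level_valuations L = (\<Inter>n. level L n)"


section \<open>Models\<close>

definition pre_model ::
  "logic \<Rightarrow> 'p fm set \<Rightarrow> ('p fm \<Rightarrow> tv) set \<Rightarrow> (('p fm \<Rightarrow> tv) \<times> ('p fm \<Rightarrow> tv)) set \<Rightarrow> bool" where
  "pre_model L \<Lambda> W R \<longleftrightarrow>
     W \<subseteq> pvals L \<Lambda> \<and> R \<subseteq> W \<times> W \<and>
     (\<forall>v\<in>W. \<forall>\<beta>\<in>\<Lambda>.
        (v \<beta> \<in> vals_P \<longrightarrow> (\<exists>w\<in>W. (v, w) \<in> R \<and> w \<beta> \<in> desig)) \<and>
        (v \<beta> \<in> vals_PN \<longrightarrow> (\<exists>w\<in>W. (v, w) \<in> R \<and> w \<beta> \<notin> desig)))"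

definition K_model ::
  "logic \<Rightarrow> 'p fm set \<Rightarrow> ('p fm \<Rightarrow> tv) set \<Rightarrow> (('p fm \<Rightarrow> tv) \<times> ('p fm \<Rightarrow> tv)) set \<Rightarrow> bool" where
  "K_model L \<Lambda> W R \<longleftrightarrow>
     pre_model L \<Lambda> W R \<and>
     (\<forall>v\<in>W. \<forall>w\<in>W. \<forall>\<beta>\<in>\<Lambda>. (v, w) \<in> R \<longrightarrow>
        (v \<beta> \<in> vals_N \<longrightarrow> w \<beta> \<in> desig) \<and> (v \<beta> \<in> vals_I \<longrightarrow> w \<beta> \<notin> desig))"

primrec scheme_cond ::
  "scheme \<Rightarrow> 'p fm set \<Rightarrow> ('p fm \<Rightarrow> tv) set \<Rightarrow> (('p fm \<Rightarrow> tv) \<times> ('p fm \<Rightarrow> tv)) set \<Rightarrow> bool" where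
  "scheme_cond AxT \<Lambda> W R \<longleftrightarrow>
     (\<forall>v\<in>W. \<forall>\<beta>\<in>\<Lambda>.
        (v \<beta> \<in> vals_N \<longrightarrow> v \<beta> \<in> desig) \<and> (v \<beta> \<in> vals_I \<longrightarrow> v \<beta> \<notin> desig))"
| "scheme_cond AxD \<Lambda> W R \<longleftrightarrow>
     (\<forall>v\<in>W. \<forall>\<beta>\<in>\<Lambda>.
        (v \<beta> \<in> vals_N \<longrightarrow> v \<beta> \<in> vals_P) \<and> (v \<beta> \<in> vals_I \<longrightarrow> v \<beta> \<in> vals_PN))"
| "scheme_cond AxB \<Lambda> W R \<longleftrightarrow>
     (\<forall>v\<in>W. \<forall>w\<in>W. \<forall>\<beta>\<in>\<Lambda>. (v, w) \<in> R \<longrightarrow>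
        (v \<beta> \<in> desig \<longrightarrow> w \<beta> \<in> vals_P) \<and> (v \<beta> \<notin> desig \<longrightarrow> w \<beta> \<in> vals_PN))"
| "scheme_cond Ax4 \<Lambda> W R \<longleftrightarrow>
     (\<forall>v\<in>W. \<forall>w\<in>W. \<forall>\<beta>\<in>\<Lambda>. (v, w) \<in> R \<longrightarrow>
        (v \<beta> \<in> vals_N \<longrightarrow> w \<beta> \<in> vals_N) \<and> (v \<beta> \<in> vals_I \<longrightarrow> w \<beta> \<in> vals_I))"
| "scheme_cond Ax5 \<Lambda> W R \<longleftrightarrow>
     (\<forall>v\<in>W. \<forall>w\<in>W. \<forall>\<beta>\<in>\<Lambda>. (v, w) \<in> R \<longrightarrow>
        (v \<beta> \<in> vals_P \<longrightarrow> w \<beta> \<in> vals_P) \<and> (v \<beta> \<in> vals_PN \<longrightarrow> w \<beta> \<in> vals_PN)) \<and>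
     (\<forall>v\<in>W. \<forall>w\<in>W. \<forall>w'\<in>W. \<forall>\<beta>\<in>\<Lambda>. (v, w) \<in> R \<and> ((v, w') \<in> R \<or> (w, w') \<in> R) \<longrightarrow>
        (v \<beta> \<in> vals_N \<and> w \<beta> \<in> vals_N \<longrightarrow> w' \<beta> \<in> vals_N) \<and>
        (v \<beta> \<in> vals_I \<and> w \<beta> \<in> vals_I \<longrightarrow> w' \<beta> \<in> vals_I))"

text \<open>A scheme holds in \<open>L\<close> if all its instances are theorems of \<open>L\<close>; it need not be one of
  the base schemes (for example, (D) holds in \<^const>\<open>KT\<close>).\<close>

definition L_model ::
  "logic \<Rightarrow> 'p fm set \<Rightarrow> ('p fm \<Rightarrow> tv) set \<Rightarrow> (('p fm \<Rightarrow> tv) \<times> ('p fm \<Rightarrow> tv)) set \<Rightarrow> bool" where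
  "L_model L \<Lambda> W R \<longleftrightarrow>
     K_model L \<Lambda> W R \<and>
     (\<forall>X. instances X \<subseteq> (theorems L :: 'p fm set) \<longrightarrow> scheme_cond X \<Lambda> W R)"

definition partial_level_valuation :: "logic \<Rightarrow> 'p fm set \<Rightarrow> ('p fm \<Rightarrow> tv) \<Rightarrow> bool" where
  "partial_level_valuation L \<Lambda> v \<longleftrightarrow> (\<exists>W R. L_model L \<Lambda> W R \<and> v \<in> W)"

end

theory Submission
  imports Defs
begin

text \<open>Read as a Kripke model in which an atom of \<open>\<Lambda>\<close> is true at \<open>v\<close> iff \<open>v\<close> designates it,
  an \<open>L\<close>-model satisfies a truth lemma on \<open>\<Lambda>\<close>: the truth value \<open>v \<beta>\<close> records whether \<open>\<beta>\<close> is true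
  at \<open>v\<close>, at some successor of \<open>v\<close>, and false at some successor of \<open>v\<close>.  Reading off this triple
  for every formula gives the required extension of \<open>v\<close>.  It survives every level because
  a formula designated by all valuations of the current level is true throughout the model.
  The accessibility relation need not satisfy the frame conditions of \<open>L\<close>, but it can be enlarged,
  keeping a \<open>K\<close>-model, until it does.\<close>

section \<open>Valuations read off a Kripke model\<close>

primrec sat :: "('w \<times> 'w) set \<Rightarrow> ('w \<Rightarrow> 'p \<Rightarrow> bool) \<Rightarrow> 'w \<Rightarrow> 'p fm \<Rightarrow> bool" where
  "sat R A w (Atom p) = A w p"
| "sat R A w Bot = False"
| "sat R A w (\<alpha> \<^bold>\<rightarrow> \<beta>) = (sat R A w \<alpha> \<longrightarrow> sat R A w \<beta>)"
| "sat R A w (\<box>\<alpha>) = (\<forall>u. (w, u) \<in> R \<longrightarrow> sat R A u \<alpha>)"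

text \<open>The arguments say whether the formula is true here, true at some successor, and
  false at some successor.\<close>

definition triple_tv :: "bool \<Rightarrow> bool \<Rightarrow> bool \<Rightarrow> tv" where
  "triple_tv a p q =
     (if a then if p then if q then vt else vT else if q then vt3 else vt2
      else if p then if q then vf else vf3 else if q then vF else vf2)"

lemmas tv_set_defs = desig_def vals_N_def vals_I_def vals_P_def vals_PN_def

lemma triple_tv_mem [simp]:
  "triple_tv a p q \<in> desig \<longleftrightarrow> a"
  "triple_tv a p q \<in> {vf2, vt2} \<longleftrightarrow> \<not> p \<and> \<not> q"
  "triple_tv a p q \<in> {vT, vt2} \<longleftrightarrow> a \<and> \<not> q"
  by (simp_all add: triple_tv_def tv_set_defs)

text \<open>The eight values realise each pattern of membership in \<open>desig\<close>,
  \<open>vals_P\<close> and \<open>vals_PN\<close> exactly once.\<close>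

lemma triple_tv_sets: "triple_tv (x \<in> desig) (x \<in> vals_P) (x \<in> vals_PN) = x"
  by (cases x) (simp_all add: triple_tv_def tv_set_defs)

lemma vals_N_iff: "x \<in> vals_N \<longleftrightarrow> x \<notin> vals_PN"
  by (cases x) (simp_all add: tv_set_defs)

lemma vals_I_iff: "x \<in> vals_I \<longleftrightarrow> x \<notin> vals_P"
  by (cases x) (simp_all add: tv_set_defs)

definition kripke_val :: "('w \<times> 'w) set \<Rightarrow> ('w \<Rightarrow> 'p \<Rightarrow> bool) \<Rightarrow> 'w \<Rightarrow> 'p fm \<Rightarrow> tv" where
  "kripke_val R A w \<beta> =
     triple_tv (sat R A w \<beta>) (\<exists>u. (w, u) \<in> R \<and> sat R A u \<beta>) (\<exists>u. (w, u) \<in> R \<and> \<not> sat R A u \<beta>)"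

primrec frame_cond :: "scheme \<Rightarrow> 'w set \<Rightarrow> ('w \<times> 'w) set \<Rightarrow> bool" where
  "frame_cond AxD W R \<longleftrightarrow> (\<forall>w\<in>W. \<exists>u. (w, u) \<in> R)"
| "frame_cond AxT W R \<longleftrightarrow> (\<forall>w\<in>W. (w, w) \<in> R)"
| "frame_cond AxB W R \<longleftrightarrow> (\<forall>w u. (w, u) \<in> R \<longrightarrow> (u, w) \<in> R)"
| "frame_cond Ax4 W R \<longleftrightarrow> (\<forall>w u x. (w, u) \<in> R \<longrightarrow> (u, x) \<in> R \<longrightarrow> (w, x) \<in> R)"
| "frame_cond Ax5 W R \<longleftrightarrow> (\<forall>w u x. (w, u) \<in> R \<longrightarrow> (w, x) \<in> R \<longrightarrow> (u, x) \<in> R)"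

text \<open>The component triples determine \<open>p''\<close>, but \<open>q''\<close> needs one
  successor making the first component true and the second false. They leave this open only when
  \<open>p\<close>, \<open>q\<close>, \<open>p'\<close>, \<open>q'\<close> all hold, hence the
  two-element entries.\<close>

lemma triple_tv_imp:
  assumes "p' \<or> q' \<longleftrightarrow> p \<or> q" "p'' \<longleftrightarrow> q \<or> p'"
    and "q'' \<Longrightarrow> p \<and> q'" "\<not> q \<Longrightarrow> q' \<Longrightarrow> q''" "\<not> p' \<Longrightarrow> p \<Longrightarrow> q''"
  shows "triple_tv (a \<longrightarrow> a') p'' q'' \<in> nm_imp (triple_tv a p q) (triple_tv a' p' q')"
  using assms by (cases a; cases a'; cases p; cases q; cases p'; cases q'; cases q'')
    (simp_all add: triple_tv_def)

lemma kripke_val_imp: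
  "kripke_val R A w (\<beta> \<^bold>\<rightarrow> \<gamma>) \<in> nm_imp (kripke_val R A w \<beta>) (kripke_val R A w \<gamma>)"
  unfolding kripke_val_def sat.simps by (rule triple_tv_imp) blast+

lemma kripke_val_Bot: "kripke_val R A w Bot \<in> nm_bot"
  by (simp add: kripke_val_def triple_tv_def nm_bot_def)

text \<open>Here \<open>p'\<close> and \<open>q'\<close> say that some successor satisfies, or
  refutes, the boxed formula; each hypothesis is what one or two frame conditions force. Under (5),
  a successor satisfying it sees all successors of the world and all their successors, which
  excludes \<open>q\<close> and \<open>q'\<close>.\<close>

lemma triple_tv_box:
  assumes dead: "p' \<or> q' \<longleftrightarrow> p \<or> q"
    and D: "AxD \<in> base_schemes L \<Longrightarrow> p \<or> q"
    and T: "AxT \<in> base_schemes L \<Longrightarrow> (if a then p else q) \<and> (if q then q' else p') \<and> (p' \<longrightarrow> p)"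
    and B: "AxB \<in> base_schemes L \<Longrightarrow> \<not> a \<Longrightarrow> \<not> p'"
    and four: "Ax4 \<in> base_schemes L \<Longrightarrow> q' \<Longrightarrow> q"
    and D4: "AxD \<in> base_schemes L \<Longrightarrow> Ax4 \<in> base_schemes L \<Longrightarrow> p' \<Longrightarrow> p"
    and five: "Ax5 \<in> base_schemes L \<Longrightarrow> \<not> (p' \<and> q) \<and> \<not> (p' \<and> q')"
    and B5: "AxB \<in> base_schemes L \<Longrightarrow> Ax5 \<in> base_schemes L \<Longrightarrow> p \<or> q \<Longrightarrow> if a then p else q"
  shows "triple_tv (\<not> q) p' q' \<in> nm_box L (triple_tv a p q)"
  \<comment> \<open>Used as conditional rewrite rules, the assumptions make the simplifier loop.\<close>
  using assms[unfolded atomize_imp]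
  by (induct L; induct a; induct p; induct q; induct p'; induct q';
      simp (no_asm_use) add: triple_tv_def)

text \<open>Seriality rules out \<open>vf2\<close> and \<open>vt2\<close>; a world seeing itself
  also rules out \<open>vf3\<close> and \<open>vt3\<close>. (B) and (5) make every world with a
  successor see itself, which explains the values of \<open>KB5\<close>.\<close>

lemma triple_tv_V:
  assumes "AxD \<in> base_schemes L \<Longrightarrow> p \<or> q"
    and "AxT \<in> base_schemes L \<Longrightarrow> if a then p else q"
    and "AxB \<in> base_schemes L \<Longrightarrow> Ax5 \<in> base_schemes L \<Longrightarrow> p \<or> q \<Longrightarrow> if a then p else q"
  shows "triple_tv a p q \<in> V L"
  using assms
  by (cases L; cases a; cases p; cases q) (simp_all add: triple_tv_def V_def)

locale kripke_frame =
  fixes L :: logic and W :: "'w set" and R :: "('w \<times> 'w) set"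
  assumes closed: "R \<subseteq> W \<times> W"
    and frame: "X \<in> base_schemes L \<Longrightarrow> frame_cond X W R"
begin

lemma serial: "AxD \<in> base_schemes L \<Longrightarrow> w \<in> W \<Longrightarrow> \<exists>u. (w, u) \<in> R"
  and refl: "AxT \<in> base_schemes L \<Longrightarrow> w \<in> W \<Longrightarrow> (w, w) \<in> R"
  and symm: "AxB \<in> base_schemes L \<Longrightarrow> (w, u) \<in> R \<Longrightarrow> (u, w) \<in> R"
  and trans: "Ax4 \<in> base_schemes L \<Longrightarrow> (w, u) \<in> R \<Longrightarrow> (u, x) \<in> R \<Longrightarrow> (w, x) \<in> R"
  and eucl: "Ax5 \<in> base_schemes L \<Longrightarrow> (w, u) \<in> R \<Longrightarrow> (w, x) \<in> R \<Longrightarrow> (u, x) \<in> R"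
  using frame[of AxD] frame[of AxT] frame[of AxB] frame[of Ax4] frame[of Ax5]
  unfolding frame_cond.simps by blast+

lemma symm_eucl_refl:
  "AxB \<in> base_schemes L \<Longrightarrow> Ax5 \<in> base_schemes L \<Longrightarrow> (w, u) \<in> R \<Longrightarrow> (w, w) \<in> R"
  using symm eucl by blast

lemma kripke_val_V:
  assumes "w \<in> W"
  shows "kripke_val R A w \<beta> \<in> V L"
  unfolding kripke_val_def
proof (rule triple_tv_V, goal_cases)
  case 1 then show ?case using serial[OF _ assms] by blast
next
  case 2 then show ?case using refl[OF _ assms] by auto
next
  case 3 then show ?case using symm_eucl_refl by (smt (verit))
qed

lemma kripke_val_box:
  assumes "w \<in> W"
  shows "kripke_val R A w (\<box>\<beta>) \<in> nm_box L (kripke_val R A w \<beta>)"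
proof -
  have W: "u \<in> W" if "(x, u) \<in> R" for x u
    using that closed by blast
  have "triple_tv (\<not> (\<exists>u. (w, u) \<in> R \<and> \<not> sat R A u \<beta>)) (\<exists>u. (w, u) \<in> R \<and> sat R A u (\<box>\<beta>))
      (\<exists>u. (w, u) \<in> R \<and> \<not> sat R A u (\<box>\<beta>)) \<in> nm_box L (kripke_val R A w \<beta>)"
    unfolding kripke_val_def
  proof (rule triple_tv_box, goal_cases)
    case 1 then show ?case by blast
  next
    case 2 then show ?case using serial[OF _ assms] by blast
  next
    case 3 then show ?case using refl[OF _ assms] refl[OF _ W] by auto
  next
    case 4 then show ?case using symm by auto
  next
    case 5 then show ?case using trans by auto
  next
    case 6 then show ?case using serial W trans by (metis sat.simps(4))
  next
    case 7 then show ?case using eucl by (metis sat.simps(4))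
  next
    case 8 then show ?case using symm_eucl_refl by (smt (verit))
  qed
  then show ?thesis
    by (simp add: kripke_val_def)
qed

lemma kripke_val_Val: "w \<in> W \<Longrightarrow> kripke_val R A w \<in> Val L"
  unfolding Val_def pvals_def
  using kripke_val_V kripke_val_imp kripke_val_box kripke_val_Bot
  by (auto simp del: nm_imp.simps nm_box.simps)

text \<open>Being a dead end does not depend on \<open>\<beta>\<close>, as level 0 demands.\<close>

lemma kripke_val_dead: "kripke_val R A w \<beta> \<in> {vf2, vt2} \<longleftrightarrow> (\<forall>u. (w, u) \<notin> R)"
  unfolding kripke_val_def triple_tv_mem by blast

lemma kripke_val_level: "w \<in> W \<Longrightarrow> kripke_val R A w \<in> level L n"
proof (induction n arbitrary: w)
  case 0
  then show ?case
    using kripke_val_Val[OF 0] unfolding level.simps mem_Collect_eq kripke_val_dead by blast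
next
  case (Suc n)
  have "kripke_val R A w \<beta> \<in> {vT, vt2}" if "\<forall>v \<in> level L n. v \<beta> \<in> desig" for \<beta>
  proof -
    have "sat R A u \<beta>" if "u \<in> W" for u
      using Suc.IH[OF that] \<open>\<forall>v \<in> level L n. v \<beta> \<in> desig\<close> by (force simp: kripke_val_def)
    then show ?thesis
      using Suc.prems closed by (auto simp: kripke_val_def simp del: insert_iff)
  qed
  then show ?case
    using Suc by auto
qed

lemma kripke_val_level_valuation: "w \<in> W \<Longrightarrow> kripke_val R A w \<in> level_valuations L"
  by (simp add: level_valuations_def kripke_val_level)

end

section \<open>The truth lemma\<close>

text \<open>The choices left open by the tables never affect designation, so truth can follow
  designation connective by connective.\<close>

lemma nm_imp_desig: "z \<in> nm_imp x y \<Longrightarrow> z \<in> desig \<longleftrightarrow> (x \<in> desig \<longrightarrow> y \<in> desig)"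
  by (cases x; cases y) (auto simp: desig_def)

lemma nm_box_desig: "z \<in> nm_box L x \<Longrightarrow> z \<in> desig \<longleftrightarrow> x \<in> vals_N"
  by (cases L; cases x) (auto simp: tv_set_defs)

context
  fixes L :: logic and \<Lambda> :: "'p fm set" and W R
  assumes model: "K_model L \<Lambda> W R"
begin

text \<open>A pre-model supplies the witness; conversely, a value outside \<open>vals_P\<close> lies
  in \<open>vals_I\<close>, which bars designated successors.\<close>

lemma model_P_iff:
  "v \<in> W \<Longrightarrow> \<beta> \<in> \<Lambda> \<Longrightarrow> v \<beta> \<in> vals_P \<longleftrightarrow> (\<exists>w\<in>W. (v, w) \<in> R \<and> w \<beta> \<in> desig)"
  using model vals_I_iff unfolding K_model_def pre_model_def by blast

lemma model_PN_iff:
  "v \<in> W \<Longrightarrow> \<beta> \<in> \<Lambda> \<Longrightarrow> v \<beta> \<in> vals_PN \<longleftrightarrow> (\<exists>w\<in>W. (v, w) \<in> R \<and> w \<beta> \<notin> desig)"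
  using model vals_N_iff unfolding K_model_def pre_model_def by blast

lemma model_closed: "R \<subseteq> W \<times> W"
  using model by (simp add: K_model_def pre_model_def)

lemma model_pvals: "v \<in> W \<Longrightarrow> v \<in> pvals L \<Lambda>"
  using model by (auto simp: K_model_def pre_model_def)

lemma truth:
  assumes "subfms \<beta> \<subseteq> \<Lambda>" "v \<in> W"
  shows "sat R (\<lambda>w p. w (Atom p) \<in> desig) v \<beta> \<longleftrightarrow> v \<beta> \<in> desig"
  using assms
proof (induction \<beta> arbitrary: v)
  case (Atom p)
  then show ?case by simp
next
  case Bot
  then show ?case
    using model_pvals[of v] by (auto simp: pvals_def nm_bot_def desig_def)
next
  case (Imp \<beta> \<gamma>)
  then have "v (\<beta> \<^bold>\<rightarrow> \<gamma>) \<in> nm_imp (v \<beta>) (v \<gamma>)"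
    using model_pvals[of v] by (auto simp: pvals_def)
  with Imp show ?case
    by (simp add: nm_imp_desig)
next
  case (Box \<beta>)
  have self: "\<beta> \<in> \<Lambda>"
    using Box.prems(1) by (cases \<beta>) auto
  have "v (\<box>\<beta>) \<in> nm_box L (v \<beta>)"
    using Box.prems model_pvals[of v] by (auto simp: pvals_def)
  then have "v (\<box>\<beta>) \<in> desig \<longleftrightarrow> v \<beta> \<notin> vals_PN"
    by (simp add: nm_box_desig vals_N_iff)
  also have "\<dots> \<longleftrightarrow> (\<forall>w. (v, w) \<in> R \<longrightarrow> w \<beta> \<in> desig)"
    using model_PN_iff[OF Box.prems(2) self] model_closed by blast
  also have "\<dots> \<longleftrightarrow> (\<forall>w. (v, w) \<in> R \<longrightarrow> sat R (\<lambda>w p. w (Atom p) \<in> desig) w \<beta>)"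
    using Box.IH Box.prems(1) model_closed by auto
  finally show ?case
    by simp
qed

lemma kripke_val_eq:
  assumes "subfm_closed \<Lambda>" "\<beta> \<in> \<Lambda>" "v \<in> W"
  shows "kripke_val R (\<lambda>w p. w (Atom p) \<in> desig) v \<beta> = v \<beta>"
proof -
  have sub: "subfms \<beta> \<subseteq> \<Lambda>"
    using assms by (auto simp: subfm_closed_def)
  have "(\<exists>u. (v, u) \<in> R \<and> sat R (\<lambda>w p. w (Atom p) \<in> desig) u \<beta>) \<longleftrightarrow> v \<beta> \<in> vals_P"
    "(\<exists>u. (v, u) \<in> R \<and> \<not> sat R (\<lambda>w p. w (Atom p) \<in> desig) u \<beta>) \<longleftrightarrow> v \<beta> \<in> vals_PN"
    using model_closed truth[OF sub] model_P_iff[OF assms(3,2)] model_PN_iff[OF assms(3,2)]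
    by (blast, blast)
  then show ?thesis
    by (simp add: kripke_val_def truth[OF sub assms(3)] triple_tv_sets)
qed

end

section \<open>Enlarging the accessibility relation\<close>

definition K_compat :: "'p fm set \<Rightarrow> ('p fm \<Rightarrow> tv) \<Rightarrow> ('p fm \<Rightarrow> tv) \<Rightarrow> bool" where
  "K_compat \<Lambda> v w \<longleftrightarrow>
     (\<forall>\<beta>\<in>\<Lambda>. (v \<beta> \<in> vals_N \<longrightarrow> w \<beta> \<in> desig) \<and> (v \<beta> \<in> vals_I \<longrightarrow> w \<beta> \<notin> desig))"

text \<open>Condition (4) says that \<open>R\<close> increases in this preorder, the first half of
  (5) that it decreases.\<close>

definition NI_le :: "'p fm set \<Rightarrow> ('p fm \<Rightarrow> tv) \<Rightarrow> ('p fm \<Rightarrow> tv) \<Rightarrow> bool" where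
  "NI_le \<Lambda> v w \<longleftrightarrow>
     (\<forall>\<beta>\<in>\<Lambda>. (v \<beta> \<in> vals_N \<longrightarrow> w \<beta> \<in> vals_N) \<and> (v \<beta> \<in> vals_I \<longrightarrow> w \<beta> \<in> vals_I))"

lemma NI_le_refl: "NI_le \<Lambda> v v"
  and NI_le_trans: "NI_le \<Lambda> u v \<Longrightarrow> NI_le \<Lambda> v w \<Longrightarrow> NI_le \<Lambda> u w"
  and K_compat_NI_le: "NI_le \<Lambda> u v \<Longrightarrow> K_compat \<Lambda> v w \<Longrightarrow> K_compat \<Lambda> u w"
  unfolding NI_le_def K_compat_def by blast+

text \<open>Pre-models only require successors to exist, so adding pairs is harmless there.\<close>

lemma K_model_mono:
  assumes "K_model L \<Lambda> W R" "R \<subseteq> R'" "R' \<subseteq> W \<times> W"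
    and "\<And>v w. (v, w) \<in> R' \<Longrightarrow> K_compat \<Lambda> v w"
  shows "K_model L \<Lambda> W R'"
proof -
  have "pre_model L \<Lambda> W R'"
    using assms(1-3) unfolding K_model_def pre_model_def by blast
  then show ?thesis
    using assms(4) unfolding K_model_def K_compat_def by blast
qed

lemma scheme_cond_B:
  "scheme_cond AxB \<Lambda> W R \<longleftrightarrow> (\<forall>v\<in>W. \<forall>w\<in>W. (v, w) \<in> R \<longrightarrow> K_compat \<Lambda> w v)"
  unfolding scheme_cond.simps K_compat_def vals_N_iff vals_I_iff by blast

lemma scheme_cond_4:
  "scheme_cond Ax4 \<Lambda> W R \<longleftrightarrow> (\<forall>v\<in>W. \<forall>w\<in>W. (v, w) \<in> R \<longrightarrow> NI_le \<Lambda> v w)"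
  unfolding scheme_cond.simps NI_le_def by blast

lemma scheme_cond_5:
  "scheme_cond Ax5 \<Lambda> W R \<Longrightarrow> v \<in> W \<Longrightarrow> w \<in> W \<Longrightarrow> (v, w) \<in> R \<Longrightarrow> NI_le \<Lambda> w v"
  unfolding scheme_cond.simps NI_le_def vals_N_iff vals_I_iff by blast

text \<open>The first half of (5) pulls membership in N or I back from \<open>w\<close> to
  \<open>v\<close>; the second half then carries it to \<open>u\<close>.\<close>

lemma scheme_cond_5_succ:
  assumes "scheme_cond Ax5 \<Lambda> W R" "v \<in> W" "w \<in> W" "u \<in> W"
    and "(v, w) \<in> R" "(v, u) \<in> R \<or> (w, u) \<in> R"
  shows "NI_le \<Lambda> w u"
proof -
  have "w \<beta> \<in> vals_N \<Longrightarrow> u \<beta> \<in> vals_N" "w \<beta> \<in> vals_I \<Longrightarrow> u \<beta> \<in> vals_I" if "\<beta> \<in> \<Lambda>" for \<beta>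
    using scheme_cond_5[OF assms(1-3,5)] assms that
    unfolding NI_le_def scheme_cond.simps by blast+
  then show ?thesis
    by (simp add: NI_le_def)
qed

text \<open>The largest relation compatible with the conditions of the schemes.\<close>

definition compat_rel :: "logic \<Rightarrow> 'p fm set \<Rightarrow> ('p fm \<Rightarrow> tv) set \<Rightarrow> (('p fm \<Rightarrow> tv) \<times> ('p fm \<Rightarrow> tv)) set" where
  "compat_rel L \<Lambda> W = {(v, w). v \<in> W \<and> w \<in> W \<and> K_compat \<Lambda> v w \<and>
     (AxB \<in> base_schemes L \<longrightarrow> K_compat \<Lambda> w v) \<and>
     (Ax4 \<in> base_schemes L \<longrightarrow> NI_le \<Lambda> v w) \<and>
     (Ax4 \<in> base_schemes L \<and> (AxB \<in> base_schemes L \<or> Ax5 \<in> base_schemes L) \<longrightarrow> NI_le \<Lambda> w v)}"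

text \<open>Without (4) the compatible pairs need not form a Euclidean relation, but under (5) any two
  points with a common predecessor agree on \<open>N\<close> and \<open>I\<close>, as do a point with a predecessor and its
  successors.\<close>

definition eucl_rel ::
  "'p fm set \<Rightarrow> (('p fm \<Rightarrow> tv) \<times> ('p fm \<Rightarrow> tv)) set \<Rightarrow> (('p fm \<Rightarrow> tv) \<times> ('p fm \<Rightarrow> tv)) set" where
  "eucl_rel \<Lambda> R = R \<union> {(v, w). v \<in> Range R \<and> w \<in> Range R \<and> NI_le \<Lambda> v w \<and> NI_le \<Lambda> w v}"

text \<open>Under (4), \<open>NI_le\<close> carries compatibility along chains of pairs. By
  \<open>no5\<close>, (5) occurs only with (4), where related points are \<open>NI_le\<close> both
  ways.\<close>

lemma compat_rel_frame:
  assumes K: "K_model L \<Lambda> W R"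
    and cond: "\<And>X. X \<in> base_schemes L \<Longrightarrow> scheme_cond X \<Lambda> W R"
    and serial: "\<And>v. AxD \<in> base_schemes L \<Longrightarrow> v \<in> W \<Longrightarrow> \<exists>w. (v, w) \<in> R"
    and no5: "Ax5 \<in> base_schemes L \<Longrightarrow> Ax4 \<in> base_schemes L"
  shows "K_model L \<Lambda> W (compat_rel L \<Lambda> W)"
    and "X \<in> base_schemes L \<Longrightarrow> frame_cond X W (compat_rel L \<Lambda> W)"
proof -
  have RW: "R \<subseteq> W \<times> W"
    using K by (simp add: K_model_def pre_model_def)
  have Kc: "K_compat \<Lambda> v w" if "(v, w) \<in> R" for v w
    using K RW that unfolding K_model_def K_compat_def by blast
  have sub: "R \<subseteq> compat_rel L \<Lambda> W"
  proof (clarify)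
    fix v w assume R: "(v, w) \<in> R"
    then have W: "v \<in> W" "w \<in> W"
      using RW by auto
    have B: "K_compat \<Lambda> w v" if "AxB \<in> base_schemes L"
      using cond[OF that] R W unfolding scheme_cond_B by blast
    have 4: "NI_le \<Lambda> v w" if "Ax4 \<in> base_schemes L"
      using cond[OF that] R W unfolding scheme_cond_4 by blast
    have 5: "NI_le \<Lambda> w v" if "Ax5 \<in> base_schemes L"
      using scheme_cond_5[OF cond[OF that] W R] .
    \<comment> \<open>With (B) and (4), symmetry makes \<open>compat_rel\<close> demand
      \<open>NI_le\<close> backwards; only \<open>KB5\<close> and \<open>S5\<close> have both, and
      their (5) supplies it.\<close>
    have "Ax5 \<in> base_schemes L" if "AxB \<in> base_schemes L" "Ax4 \<in> base_schemes L"
      using that by (cases L) auto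
    with B 4 5 Kc[OF R] W show "(v, w) \<in> compat_rel L \<Lambda> W"
      unfolding compat_rel_def by blast
  qed
  show "K_model L \<Lambda> W (compat_rel L \<Lambda> W)"
    by (rule K_model_mono[OF K sub]) (auto simp: compat_rel_def)
  show "frame_cond X W (compat_rel L \<Lambda> W)" if X: "X \<in> base_schemes L"
  proof (cases X)
    case AxD
    then show ?thesis
      using serial sub X by (simp, blast)
  next
    case AxT
    then have "K_compat \<Lambda> v v" if "v \<in> W" for v
      using cond[OF X] that by (auto simp: K_compat_def)
    with AxT show ?thesis
      by (simp add: compat_rel_def NI_le_refl)
  next
    case AxB
    with X show ?thesis
      by (auto simp: compat_rel_def)
  next
    case Ax4
    with X show ?thesis
      unfolding compat_rel_def frame_cond.simps
      by simp (blast intro: NI_le_trans K_compat_NI_le)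
  next
    case Ax5
    with X no5 show ?thesis
      unfolding compat_rel_def frame_cond.simps
      by simp (blast intro: NI_le_trans K_compat_NI_le)
  qed
qed

lemma eucl_rel_frame:
  assumes K: "K_model L \<Lambda> W R" and 5: "scheme_cond Ax5 \<Lambda> W R"
  shows "K_model L \<Lambda> W (eucl_rel \<Lambda> R)"
    and "frame_cond Ax5 W (eucl_rel \<Lambda> R)"
proof -
  have RW: "R \<subseteq> W \<times> W"
    using K by (simp add: K_model_def pre_model_def)
  have Kc: "K_compat \<Lambda> v w" if "(v, w) \<in> R" for v w
    using K RW that unfolding K_model_def K_compat_def by blast
  have le: "NI_le \<Lambda> w v" if "(v, w) \<in> R" for v w
    using scheme_cond_5[OF 5] RW that by blast
  have succ: "NI_le \<Lambda> w u" if "(v, w) \<in> R" "(v, u) \<in> R \<or> (w, u) \<in> R" for u v w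
    using scheme_cond_5_succ[OF 5] RW that by blast
  show "K_model L \<Lambda> W (eucl_rel \<Lambda> R)"
  proof (rule K_model_mono[OF K])
    fix v w assume "(v, w) \<in> eucl_rel \<Lambda> R"
    \<comment> \<open>In a new pair, \<open>w\<close> has an \<open>R\<close>-predecessor
      \<open>x\<close>. As \<open>NI_le\<close> leads from \<open>v\<close> to \<open>w\<close> and,
      by (5), on to \<open>x\<close>, \<open>v\<close> inherits the compatibility of
      \<open>x\<close> with \<open>w\<close>.\<close>
    then consider "(v, w) \<in> R" | x where "(x, w) \<in> R" "NI_le \<Lambda> v w"
      by (auto simp: eucl_rel_def)
    then show "K_compat \<Lambda> v w"
      by cases (use Kc le NI_le_trans K_compat_NI_le in blast)+
  qed (use RW in \<open>auto simp: eucl_rel_def\<close>)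
  have NI_eq: "NI_le \<Lambda> u v \<and> NI_le \<Lambda> v u"
    if "v \<in> Range R" "(v, u) \<in> eucl_rel \<Lambda> R" for u v
    using that succ le unfolding eucl_rel_def by blast
  have "(u, x) \<in> eucl_rel \<Lambda> R" if ux: "(v, u) \<in> eucl_rel \<Lambda> R" "(v, x) \<in> eucl_rel \<Lambda> R" for u v x
  proof -
    \<comment> \<open>Targets lie in \<open>Range R\<close>, so agreement on N and I suffices. If
      \<open>v\<close> has a predecessor, both points agree with \<open>v\<close>; otherwise both
      pairs come from \<open>R\<close>.\<close>
    have "NI_le \<Lambda> u x \<and> NI_le \<Lambda> x u"
    proof (cases "v \<in> Range R")
      case True
      then show ?thesis
        using NI_eq ux NI_le_trans by blast
    next
      case False
      then show ?thesis
        using ux succ by (auto simp: eucl_rel_def)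
    qed
    with ux show ?thesis
      by (auto simp: eucl_rel_def)
  qed
  then show "frame_cond Ax5 W (eucl_rel \<Lambda> R)"
    unfolding frame_cond.simps by blast
qed

lemma L_model_frame:
  fixes \<Lambda> :: "'p fm set"
  assumes "L_model L \<Lambda> W R"
  obtains R' where "K_model L \<Lambda> W R'" "\<And>X. X \<in> base_schemes L \<Longrightarrow> frame_cond X W R'"
proof -
  \<comment> \<open>If \<open>\<Lambda>\<close> is empty, an \<open>L\<close>-model need not be serial.\<close>
  define S where "S = (if \<Lambda> = {} then W \<times> W else R)"
  have "K_model L \<Lambda> W R"
    using assms by (simp add: L_model_def)
  then have K: "K_model L \<Lambda> W S"
    by (auto simp: S_def K_model_def pre_model_def)
  have cond: "scheme_cond X \<Lambda> W S" if "X \<in> base_schemes L" for X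
  proof (cases "\<Lambda> = {}")
    case True
    then show ?thesis by (cases X) auto
  next
    case False
    have "instances X \<subseteq> (theorems L :: 'p fm set)"
      using theorems.ax_scheme[OF that] by blast
    then show ?thesis
      using assms False by (simp add: L_model_def S_def)
  qed
  have serial: "\<exists>w. (v, w) \<in> S" if "AxD \<in> base_schemes L" "v \<in> W" for v
  proof (cases "\<Lambda> = {}")
    case True
    then show ?thesis
      using that by (auto simp: S_def)
  next
    case False
    then obtain \<beta> where \<beta>: "\<beta> \<in> \<Lambda>" by blast
    \<comment> \<open>(D) puts values in \<open>vals_N\<close> into \<open>vals_P\<close>; all
      others are in \<open>vals_PN\<close>.\<close>
    have "v \<beta> \<in> vals_P \<or> v \<beta> \<in> vals_PN"
      using cond[OF that(1)] \<beta> that(2) by (auto simp: vals_N_iff)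
    then show ?thesis
      using K \<beta> that(2) unfolding K_model_def pre_model_def by blast
  qed
  show thesis
  \<comment> \<open>The first case is \<open>K5\<close> and \<open>KD5\<close>, where besides (5) at
    most seriality is required, and it passes to larger relations.\<close>
  proof (cases "Ax5 \<in> base_schemes L \<and> Ax4 \<notin> base_schemes L")
    case True
    then have schemes: "base_schemes L \<subseteq> {AxD, Ax5}"
      by (cases L) auto
    show ?thesis
    proof (rule that)
      show "K_model L \<Lambda> W (eucl_rel \<Lambda> S)"
        using eucl_rel_frame(1)[OF K] cond True by blast
      show "frame_cond X W (eucl_rel \<Lambda> S)" if "X \<in> base_schemes L" for X
      proof (cases "X = AxD")
        case True
        with that serial show ?thesis
          by (force simp: eucl_rel_def)
      next
        case False
        with that schemes show ?thesis
          using eucl_rel_frame(2)[OF K] cond by blast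
      qed
    qed
  next
    case False
    then show ?thesis
      using that compat_rel_frame[OF K cond serial] by blast
  qed
qed

theorem theorem4:
  fixes L :: logic and \<Lambda> :: "'p fm set" and v :: "'p fm \<Rightarrow> tv"
  assumes "subfm_closed \<Lambda>"
    and "partial_level_valuation L \<Lambda> v"
  shows "\<exists>v' \<in> level_valuations L. \<forall>\<beta>\<in>\<Lambda>. v' \<beta> = v \<beta>"
proof -
  obtain W R where "L_model L \<Lambda> W R" and v: "v \<in> W"
    using assms(2) by (auto simp: partial_level_valuation_def)
  then obtain R' where K: "K_model L \<Lambda> W R'"
    and frame: "\<And>X. X \<in> base_schemes L \<Longrightarrow> frame_cond X W R'"
    using L_model_frame by blast
  interpret kripke_frame L W R'
    using model_closed[OF K] frame by unfold_locales
  \<comment> \<open>The witness evaluates atoms by designation; outside \<open>\<Lambda>\<close>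
    every point of \<open>W\<close> has the value \<open>undefined\<close>, so such atoms have one
    arbitrary truth value throughout \<open>W\<close>.\<close>
  show ?thesis
    using kripke_val_level_valuation[OF v] kripke_val_eq[OF K assms(1) _ v] by blast
qed

end
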